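(* Let $f$ and $g$ be transcendental entire functions which are conjugate under a conformal map $\phi:\mathbb{C}\to\mathbb{C}$, that is, $\phi\circ f=g\circ\phi$. Then: (i) $AV(g)=\phi(AV(f))$; (ii) $\phi(CP(f))\subset CP(g)$; (iii) $\phi(CV(f))\subset CV(g)$; (iv) $CP(f)\subset CP(\phi\circ f)$; (v) if $\phi(CP(g))\subset CP(g)$, then $CP(g)\subset CP(f)$.
   Context: A conformal map $\phi:\mathbb{C}\to\mathbb{C}$ means an analytic and univalent (injective) map of the complex plane. For an entire function $h$: $CP(h)=\{z\in\mathbb{C}: h'(z)=0\}$ is the set of critical points; $CV(h)=h(CP(h))$ is the set of critical values; a point $\zeta\in\mathbb{C}$ is an asymptotic value of $h$ if there exists a curve $\Gamma$ tending to infinity such that $h(z)\to\zeta$ as $z\to\infty$ along $\Gamma$, and $AV(h)\subset\mathbb{C}$ is the set of all asymptotic values of $h$. *)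

theory Defs
  imports "HOL-Complex_Analysis.Complex_Analysis" "HOL-Computational_Algebra.Polynomial"
begin

definition entire :: "(complex \<Rightarrow> complex) \<Rightarrow> bool" where
  "entire h \<longleftrightarrow> h holomorphic_on UNIV"

definition transcendental_entire :: "(complex \<Rightarrow> complex) \<Rightarrow> bool" where
  "transcendental_entire h \<longleftrightarrow> entire h \<and> \<not> (\<exists>p :: complex poly. h = poly p)"

definition conformal_map :: "(complex \<Rightarrow> complex) \<Rightarrow> bool" where
  "conformal_map \<phi> \<longleftrightarrow> \<phi> analytic_on UNIV \<and> inj \<phi>"

definition conjugate_under ::
  "(complex \<Rightarrow> complex) \<Rightarrow> (complex \<Rightarrow> complex) \<Rightarrow> (complex \<Rightarrow> complex) \<Rightarrow> bool" where
  "conjugate_under \<phi> f g \<longleftrightarrow> \<phi> \<circ> f = g \<circ> \<phi>"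

definition CP :: "(complex \<Rightarrow> complex) \<Rightarrow> complex set" where
  "CP h = {z. deriv h z = 0}"

definition CV :: "(complex \<Rightarrow> complex) \<Rightarrow> complex set" where
  "CV h = h ` CP h"

(* A curve tending to infinity is a continuous map \<gamma> on [0, \<infinity>) with |\<gamma> t| \<longrightarrow> \<infinity>
   as t \<longrightarrow> \<infinity>; it need not be injective. *)
definition asymptotic_value :: "(complex \<Rightarrow> complex) \<Rightarrow> complex \<Rightarrow> bool" where
  "asymptotic_value h \<zeta> \<longleftrightarrow>
     (\<exists>\<gamma> :: real \<Rightarrow> complex. continuous_on {0..} \<gamma> \<and> filterlim \<gamma> at_infinity at_top \<and>
        ((\<lambda>t. h (\<gamma> t)) \<longlongrightarrow> \<zeta>) at_top)"

definition AV :: "(complex \<Rightarrow> complex) \<Rightarrow> complex set" where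
  "AV h = {\<zeta>. asymptotic_value h \<zeta>}"

end

theory Submission
  imports Defs
begin

text \<open>
  Everything but the statement on asymptotic values is the chain rule together with the fact that
  an injective holomorphic function has no critical point. For asymptotic values, \<open>\<phi>\<close> must carry
  curves tending to infinity to curves tending to infinity. By Casorati--Weierstrass, infinity
  is not an essential singularity of an injective entire function, and by Liouville it is then a
  pole. Hence \<open>\<phi>\<close> is also onto, its inverse is again conformal and conjugates \<open>g\<close> back
  to \<open>f\<close>, so the inclusion for \<open>\<phi>\<close> implies the equality.
\<close>

lemma conformal_map_holomorphic: "conformal_map \<phi> \<Longrightarrow> \<phi> holomorphic_on UNIV"
  by (simp add: conformal_map_def analytic_imp_holomorphic)

lemma conformal_map_deriv_nonzero: "conformal_map \<phi> \<Longrightarrow> deriv \<phi> z \<noteq> 0"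
  by (rule holomorphic_injective_imp_regular[of _ UNIV])
     (auto simp: conformal_map_holomorphic conformal_map_def)

text \<open>By Liouville an entire function with a finite limit at infinity is constantly equal to
  that limit, so already the values at 0 and 1 contradict injectivity.\<close>

lemma conformal_map_not_tendsto_at_infinity:
  assumes "conformal_map \<phi>"
  shows "\<not> (\<phi> \<longlongrightarrow> l) at_infinity"
proof
  assume "(\<phi> \<longlongrightarrow> l) at_infinity"
  then have "\<phi> 0 = l" "\<phi> 1 = l"
    using Liouville_weak conformal_map_holomorphic[OF assms] by blast+
  then have "\<phi> 0 = \<phi> 1" by simp
  moreover have "inj \<phi>"
    using assms by (simp add: conformal_map_def)
  ultimately have "(0::complex) = 1" by (rule injD[rotated])
  then show False by simp
qed

text \<open>Otherwise \<phi> would map the exterior of the unit disc onto a dense set, which has to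
  meet the open image of the disc itself. A common value contradicts injectivity.\<close>

lemma conformal_map_no_essential_singularity:
  assumes "conformal_map \<phi>"
  shows "\<exists>l. (\<phi> \<longlongrightarrow> l) at_infinity \<or> ((inverse \<circ> \<phi>) \<longlongrightarrow> l) at_infinity"
proof (rule ccontr)
  assume no_limit: "\<not> ?thesis"
  \<comment> \<open>Inversion moves the singularity from infinity to 0; the punctured unit disc now
    stands for the exterior of the closed disc.\<close>
  let ?h = "\<phi> \<circ> inverse"
  have "closure (?h ` (ball 0 1 - {0})) = UNIV"
  proof (rule Casorati_Weierstrass)
    show "?h holomorphic_on (ball 0 1 - {0})"
      by (intro holomorphic_on_compose holomorphic_intros
          holomorphic_on_subset[OF conformal_map_holomorphic[OF assms]]) auto
    show "\<not> (?h \<longlongrightarrow> l) (at 0)" "\<not> ((inverse \<circ> ?h) \<longlongrightarrow> l) (at 0)" for l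
      using no_limit by (auto simp: lim_at_infinity_0 o_assoc)
  qed auto
  moreover have "open (\<phi> ` ball 0 1)"
    using assms conformal_map_holomorphic
    by (intro open_mapping_thm3)
       (auto simp: conformal_map_def intro: holomorphic_on_subset inj_on_subset)
  ultimately have "\<phi> ` ball 0 1 \<inter> ?h ` (ball 0 1 - {0}) \<noteq> {}"
    by (subst open_Int_closure_eq_empty[symmetric]) auto
  then obtain a b where ab: "norm a < 1" "norm b < 1" "b \<noteq> 0" "\<phi> a = \<phi> (inverse b)"
    by fastforce
  then have "a = inverse b"
    using assms by (auto simp: conformal_map_def dest: injD)
  then show False
    using ab one_less_inverse[of "norm b"] by (simp add: norm_inverse)
qed

lemma conformal_map_filterlim_at_infinity:
  assumes "conformal_map \<phi>"
  shows "filterlim \<phi> at_infinity at_infinity"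
proof -
  obtain l where l: "((inverse \<circ> \<phi>) \<longlongrightarrow> l) at_infinity"
    using conformal_map_no_essential_singularity[OF assms]
      conformal_map_not_tendsto_at_infinity[OF assms] by blast
  have "l = 0"
  proof (rule ccontr)
    assume "l \<noteq> 0"
    then have "(\<phi> \<longlongrightarrow> inverse l) at_infinity"
      using tendsto_inverse[OF l] by simp
    then show False
      using conformal_map_not_tendsto_at_infinity[OF assms] by blast
  qed
  \<comment> \<open>The filter \<open>at 0\<close> is punctured, and \<open>inverse 0 = 0\<close>,
    so zeros of \<phi> must be kept away from infinity. Injectivity leaves at most one.\<close>
  moreover have "\<forall>\<^sub>F z in at_infinity. inverse (\<phi> z) \<noteq> 0"
  proof -
    have "finite {z. \<phi> z = 0}"
      using finite_vimageI[of "{0}" \<phi>] assms by (simp add: conformal_map_def vimage_def)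
    then have "bounded {z. \<phi> z = 0}" by (rule finite_imp_bounded)
    then obtain B where "\<And>z. \<phi> z = 0 \<Longrightarrow> norm z \<le> B"
      by (auto simp: bounded_iff)
    then show ?thesis
      unfolding eventually_at_infinity by (intro exI[of _ "B + 1"]) fastforce
  qed
  ultimately have "filterlim (inverse \<circ> \<phi>) (at 0) at_infinity"
    using l by (simp add: filterlim_at)
  then have "filterlim (\<lambda>z. inverse (inverse (\<phi> z))) at_infinity at_infinity"
    unfolding o_def by (rule filterlim_compose[OF filterlim_inverse_at_infinity])
  then show ?thesis by simp
qed

text \<open>If a value \<open>w\<close> were omitted, \<open>1 / (\<phi> z - w)\<close> would be
  entire and tend to 0 at infinity, hence vanish identically by Liouville.\<close>

lemma conformal_map_surj:
  assumes "conformal_map \<phi>"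
  shows "surj \<phi>"
proof -
  have "\<exists>z. \<phi> z = w" for w
  proof -
    have "filterlim (\<lambda>z. \<phi> z + (- w)) at_infinity at_infinity"
      by (rule tendsto_add_filterlim_at_infinity'
          [OF conformal_map_filterlim_at_infinity[OF assms] tendsto_const])
    then have "filterlim (\<lambda>z. norm (\<phi> z - w)) at_top at_infinity"
      by (simp add: filterlim_at_infinity_conv_norm_at_top)
    then have "\<forall>\<^sub>F z in at_infinity. B \<le> norm (\<phi> z - w)" for B
      by (simp add: filterlim_at_top)
    moreover have "(\<lambda>z. \<phi> z - w) holomorphic_on UNIV"
      by (intro holomorphic_intros conformal_map_holomorphic[OF assms])
    ultimately obtain z where "\<phi> z - w = 0"
      using Liouville_weak_inverse by blast
    then show ?thesis by auto
  qed
  then show ?thesis by (metis surjI)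
qed

text \<open>The holomorphic inverse supplied by the library lives on \<open>range \<phi>\<close>;
  surjectivity makes this the whole plane and identifies that inverse with
  \<open>inv \<phi>\<close>.\<close>

lemma conformal_map_inv:
  assumes "conformal_map \<phi>"
  shows "conformal_map (inv \<phi>)"
proof -
  have inj: "inj \<phi>" and surj: "surj \<phi>"
    using assms conformal_map_surj by (auto simp: conformal_map_def)
  obtain \<psi> where "\<psi> holomorphic_on range \<phi>" "\<And>z. \<psi> (\<phi> z) = z"
    using holomorphic_has_inverse[OF conformal_map_holomorphic[OF assms] open_UNIV inj]
    by (metis UNIV_I)
  moreover from this have "inv \<phi> = \<psi>"
    using surj by (intro ext) (metis surj_f_inv_f)
  ultimately have "inv \<phi> holomorphic_on UNIV"
    using surj by simp
  then show ?thesis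
    using surj by (simp add: conformal_map_def analytic_on_open surj_imp_inj_inv)
qed

text \<open>The image under \<phi> of a curve for \<open>f\<close> is a curve for \<open>g\<close>:
  it still tends to infinity, and along it \<open>g\<close> takes the values of
  \<open>\<phi> \<circ> f\<close>, which converge by continuity of \<phi>.\<close>

lemma image_AV_subset:
  assumes \<phi>: "conformal_map \<phi>" and conj: "conjugate_under \<phi> f g"
  shows "\<phi> ` AV f \<subseteq> AV g"
proof (rule image_subsetI)
  fix \<zeta> assume "\<zeta> \<in> AV f"
  then obtain \<gamma> :: "real \<Rightarrow> complex"
    where cont: "continuous_on {0..} \<gamma>" and inf: "filterlim \<gamma> at_infinity at_top"
      and lim: "((\<lambda>t. f (\<gamma> t)) \<longlongrightarrow> \<zeta>) at_top"
    by (auto simp: AV_def asymptotic_value_def)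
  have \<phi>_cont: "continuous_on UNIV \<phi>"
    by (intro holomorphic_on_imp_continuous_on conformal_map_holomorphic \<phi>)
  have "continuous_on {0..} (\<lambda>t. \<phi> (\<gamma> t))"
    by (intro continuous_on_compose2[OF \<phi>_cont cont]) simp
  moreover have "filterlim (\<lambda>t. \<phi> (\<gamma> t)) at_infinity at_top"
    by (intro filterlim_compose[OF conformal_map_filterlim_at_infinity[OF \<phi>] inf])
  moreover have "((\<lambda>t. g (\<phi> (\<gamma> t))) \<longlongrightarrow> \<phi> \<zeta>) at_top"
  proof -
    have "isCont \<phi> \<zeta>"
      using \<phi>_cont by (simp add: continuous_on_eq_continuous_at)
    then have "((\<lambda>t. \<phi> (f (\<gamma> t))) \<longlongrightarrow> \<phi> \<zeta>) at_top"
      using lim by (rule isCont_tendsto_compose)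
    moreover have "\<phi> (f z) = g (\<phi> z)" for z
      using conj by (metis conjugate_under_def comp_apply)
    ultimately show ?thesis by simp
  qed
  ultimately show "\<phi> \<zeta> \<in> AV g"
    unfolding AV_def asymptotic_value_def mem_Collect_eq
    by (intro exI[of _ "\<lambda>t. \<phi> (\<gamma> t)"] conjI)
qed

lemma AV_eq_image:
  assumes \<phi>: "conformal_map \<phi>" and conj: "conjugate_under \<phi> f g"
  shows "AV g = \<phi> ` AV f"
proof
  have inj: "inj \<phi>" and surj: "surj \<phi>"
    using \<phi> conformal_map_surj by (auto simp: conformal_map_def)
  \<comment> \<open>The conjugacy is reversed so that the inclusion just proved applies with
    \<open>f\<close> and \<open>g\<close> exchanged.\<close>
  have "conjugate_under (inv \<phi>) g f"
    unfolding conjugate_under_def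
  proof
    fix w
    obtain z where w: "w = \<phi> z" using surj by (metis surjD)
    have "g (\<phi> z) = \<phi> (f z)"
      using conj by (metis conjugate_under_def comp_apply)
    then show "(inv \<phi> \<circ> g) w = (f \<circ> inv \<phi>) w"
      using inj w by simp
  qed
  then have "inv \<phi> ` AV g \<subseteq> AV f"
    by (intro image_AV_subset conformal_map_inv \<phi>)
  then have "\<phi> ` inv \<phi> ` AV g \<subseteq> \<phi> ` AV f" by (rule image_mono)
  then show "AV g \<subseteq> \<phi> ` AV f"
    using surj by (simp add: image_f_inv_f)
  show "\<phi> ` AV f \<subseteq> AV g"
    using assms by (rule image_AV_subset)
qed

theorem theorem2p4:
  fixes f g \<phi> :: "complex \<Rightarrow> complex"
  assumes "transcendental_entire f"
    and "transcendental_entire g"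
    and "conformal_map \<phi>"
    and "conjugate_under \<phi> f g"
  shows "AV g = \<phi> ` AV f \<and>
         \<phi> ` CP f \<subseteq> CP g \<and>
         \<phi> ` CV f \<subseteq> CV g \<and>
         CP f \<subseteq> CP (\<phi> \<circ> f) \<and>
         (\<phi> ` CP g \<subseteq> CP g \<longrightarrow> CP g \<subseteq> CP f)"
proof -
  have diff: "h field_differentiable at z" if "h holomorphic_on UNIV" for h :: "complex \<Rightarrow> complex" and z
    using that by (auto intro: holomorphic_on_imp_differentiable_at)
  have f: "f field_differentiable at z" and g: "g field_differentiable at z"
    and \<phi>: "\<phi> field_differentiable at z" for z
    using assms(1-3)
    by (auto intro!: diff simp: transcendental_entire_def entire_def conformal_map_holomorphic)
  have deriv_\<phi>f: "deriv (\<phi> \<circ> f) z = deriv \<phi> (f z) * deriv f z"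
    and deriv_g\<phi>: "deriv (g \<circ> \<phi>) z = deriv g (\<phi> z) * deriv \<phi> z" for z
    by (intro deriv_chain f g \<phi>)+
  have conj: "\<phi> \<circ> f = g \<circ> \<phi>"
    using assms(4) by (simp add: conjugate_under_def)
  \<comment> \<open>Both chain rules compute the derivative of the same function, and the factors
    coming from \<phi> never vanish. The forward direction gives the last claim: if \<open>z\<close>
    and hence \<open>\<phi> z\<close> is critical for \<open>g\<close>, then \<open>z\<close> is
    critical for \<open>f\<close>.\<close>
  have CP_iff: "\<phi> z \<in> CP g \<longleftrightarrow> z \<in> CP f" for z
    using deriv_\<phi>f[of z] deriv_g\<phi>[of z] conformal_map_deriv_nonzero[OF assms(3)]
    by (auto simp: CP_def conj)
  have "\<phi> ` CV f \<subseteq> CV g"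
  proof -
    have "\<phi> ` CV f = (\<phi> \<circ> f) ` CP f" by (simp add: CV_def image_comp)
    also have "\<dots> = g ` \<phi> ` CP f" by (simp add: conj image_comp)
    also have "\<dots> \<subseteq> CV g" using CP_iff by (auto simp: CV_def)
    finally show ?thesis .
  qed
  moreover have "CP f \<subseteq> CP (\<phi> \<circ> f)"
    by (auto simp: CP_def deriv_\<phi>f)
  moreover have "AV g = \<phi> ` AV f"
    using assms(3,4) by (rule AV_eq_image)
  ultimately show ?thesis
    using CP_iff by blast
qed

end
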